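(* Let $M$ be a connected matroid, let $N$ be a binary matroid, and let $f: M \rightarrow N$ be a matroid homomorphism. Then either, for every $x \in E(N)$, the set $f^{-1}(x)$ is a series class of $M$, or $N$ is a circuit (that is, $E(N) \in \mathcal{C}(N)$).
   Context: For a matroid $X$, $E(X)$ denotes its ground set and $\mathcal{C}(X)$ its set of circuits. A matroid homomorphism $f: M \rightarrow N$ is a map $f: E(M) \rightarrow E(N)$ from the ground set of $M$ onto the ground set of $N$ such that $f(C) \in \mathcal{C}(N)$ for every $C \in \mathcal{C}(M)$. A set $S \subseteq E(M)$ is called a series class of $M$ if its elements are pairwise in series, i.e., every circuit of $M$ that meets $S$ contains $S$ (equivalently, there are no $x_1, x_2 \in S$ and $A \in \mathcal{C}(M)$ with $x_1 \in A$, $x_2 \notin A$). *)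

theory Defs
  imports Main "HOL-Library.Z2"
begin

record 'a matroid =
  ground :: "'a set"
  indep :: "'a set set"

locale matroid =
  fixes M :: "'a matroid"
  assumes finite_ground: "finite (ground M)"
    and indep_subset_ground: "X \<in> indep M \<Longrightarrow> X \<subseteq> ground M"
    and indep_empty: "{} \<in> indep M"
    and indep_subset: "X \<in> indep M \<Longrightarrow> Y \<subseteq> X \<Longrightarrow> Y \<in> indep M"
    and indep_augment:
      "X \<in> indep M \<Longrightarrow> Y \<in> indep M \<Longrightarrow> card X < card Y \<Longrightarrow>
        \<exists>y \<in> Y - X. insert y X \<in> indep M"

definition circuits :: "'a matroid \<Rightarrow> 'a set set" where
  "circuits M = {C. C \<subseteq> ground M \<and> C \<notin> indep M \<and> (\<forall>D. D \<subset> C \<longrightarrow> D \<in> indep M)}"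

definition connected_matroid :: "'a matroid \<Rightarrow> bool" where
  "connected_matroid M \<longleftrightarrow> matroid M \<and>
    (\<forall>x \<in> ground M. \<forall>y \<in> ground M. x \<noteq> y \<longrightarrow> (\<exists>C \<in> circuits M. x \<in> C \<and> y \<in> C))"

text \<open>Linear independence over GF(2) of the family of vectors
  \<open>(v e 0, \<dots>, v e (n - 1))\<close> indexed by \<open>e \<in> X\<close>, for finite \<open>X\<close>.  Being about families rather
  than sets of vectors, it makes two indices carrying the same vector dependent.\<close>

definition lin_indep_family_GF2 :: "nat \<Rightarrow> ('a \<Rightarrow> nat \<Rightarrow> bit) \<Rightarrow> 'a set \<Rightarrow> bool" where
  "lin_indep_family_GF2 n v X \<longleftrightarrow>
    (\<forall>c :: 'a \<Rightarrow> bit. (\<forall>i<n. (\<Sum>e\<in>X. c e * v e i) = 0) \<longrightarrow> (\<forall>e\<in>X. c e = 0))"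

text \<open>A matroid is binary if it is the vector matroid of a matrix over GF(2); below,
  \<open>v e\<close> is the column of length \<open>n\<close> labelled by \<open>e\<close>.\<close>

definition binary_matroid :: "'a matroid \<Rightarrow> bool" where
  "binary_matroid M \<longleftrightarrow> matroid M \<and>
    (\<exists>n v. \<forall>X \<subseteq> ground M. X \<in> indep M \<longleftrightarrow> lin_indep_family_GF2 n v X)"

definition matroid_hom :: "'a matroid \<Rightarrow> 'b matroid \<Rightarrow> ('a \<Rightarrow> 'b) \<Rightarrow> bool" where
  "matroid_hom M N f \<longleftrightarrow>
    f ` ground M = ground N \<and> (\<forall>C \<in> circuits M. f ` C \<in> circuits N)"

text \<open>A series class here is only required to consist of elements
  that are pairwise in series; it need not be maximal with this property.\<close>

definition series_class :: "'a matroid \<Rightarrow> 'a set \<Rightarrow> bool" where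
  "series_class M S \<longleftrightarrow>
    S \<subseteq> ground M \<and> (\<forall>C \<in> circuits M. C \<inter> S \<noteq> {} \<longrightarrow> S \<subseteq> C)"

end

theory Submission
  imports Defs
begin

text \<open>
  Adding to a circuit \<open>A\<close> an ear \<open>C - A\<close> that is minimal through a prescribed element gives a
  theta configuration, in which any two distinct circuits cover everything. In a binary matroid
  the symmetric difference of two circuits is empty or dependent, and this leaves two
  possibilities for the images under \<open>f\<close>: either all circuits of the theta have the same image,
  or the theta consists of exactly three paths, whose images are pairwise disjoint.

  If a fibre of \<open>f\<close> is not a series class, connectedness gives a theta of the first kind, formed by
  circuits \<open>A\<close> and \<open>C\<close>, say with image \<open>Z\<close>. If \<open>Z \<noteq> E(N)\<close>, attach to \<open>A \<union> C\<close> an ear \<open>D\<close> through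
  an element mapped outside \<open>Z\<close>. Then \<open>D\<close> forms a theta of the second kind with \<open>A\<close> and with \<open>C\<close>,
  and splits both of them. Binarity makes the images of the two splittings agree, and
  eliminating \<open>D\<close> shows that the splittings themselves agree, so that \<open>A = C\<close>, a contradiction.
\<close>

section \<open>Circuits\<close>

lemma circuits_subset_eq:
  assumes "C \<in> circuits M" "D \<in> circuits M" "C \<subseteq> D"
  shows "C = D"
  using assms unfolding circuits_def by blast

lemma dependent_subset_circuit_eq:
  assumes "C \<in> circuits M" "D \<subseteq> C" "D \<notin> indep M"
  shows "D = C"
  using assms unfolding circuits_def by blast

context matroid
begin

lemma circuit_finite: "C \<in> circuits M \<Longrightarrow> finite C"
  using finite_ground finite_subset unfolding circuits_def by blast

lemma circuit_nonempty: "C \<in> circuits M \<Longrightarrow> C \<noteq> {}"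
  using indep_empty unfolding circuits_def by blast

lemma dependent_contains_circuit:
  assumes "X \<subseteq> ground M" "X \<notin> indep M"
  shows "\<exists>C \<in> circuits M. C \<subseteq> X"
proof -
  have "finite X" using assms(1) finite_ground finite_subset by blast
  then show ?thesis using assms
  proof (induction X rule: finite_psubset_induct)
    case (psubset X)
    show ?case
    proof (cases "\<forall>D. D \<subset> X \<longrightarrow> D \<in> indep M")
      case True
      then have "X \<in> circuits M" using psubset.prems unfolding circuits_def by blast
      then show ?thesis by blast
    next
      case False
      then obtain D where D: "D \<subset> X" "D \<notin> indep M" by blast
      then obtain C where "C \<in> circuits M" "C \<subseteq> D"
        using psubset.IH[of D] psubset.prems(1) by blast
      then show ?thesis using D(1) by blast
    qed
  qed
qed

text \<open>Otherwise \<open>?U - {e}\<close> is independent. A maximal independent \<open>I\<close>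
  with \<open>C2 - {x} \<subseteq> I \<subseteq> ?U\<close> misses both \<open>x\<close> and some
  \<open>g\<close> of \<open>C1\<close>, so it is smaller than \<open>?U - {e}\<close>, and
  augmentation contradicts maximality.\<close>

lemma circuit_elimination:
  assumes C1: "C1 \<in> circuits M" and C2: "C2 \<in> circuits M" and ne: "C1 \<noteq> C2"
    and e: "e \<in> C1" "e \<in> C2"
  shows "\<exists>C \<in> circuits M. C \<subseteq> C1 \<union> C2 - {e}"
proof (rule ccontr)
  assume no: "\<not> ?thesis"
  let ?U = "C1 \<union> C2"
  have U: "?U \<subseteq> ground M" "finite ?U"
    using C1 C2 circuit_finite unfolding circuits_def by auto
  have J: "?U - {e} \<in> indep M"
    using no dependent_contains_circuit[of "?U - {e}"] U(1) by blast
  obtain x where x: "x \<in> C2" "x \<notin> C1"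
    using circuits_subset_eq[OF C2 C1] ne by blast
  let ?F = "{I. I \<in> indep M \<and> C2 - {x} \<subseteq> I \<and> I \<subseteq> ?U}"
  have "C2 - {x} \<in> ?F" using C2 x unfolding circuits_def by blast
  moreover have "finite ?F" using U(2) finite_subset[of ?F "Pow ?U"] by blast
  ultimately have "\<exists>I \<in> ?F. \<forall>I' \<in> ?F. I \<subseteq> I' \<longrightarrow> I = I'"
    by (intro finite_has_maximal) auto
  then obtain I where I: "I \<in> ?F" and max: "\<And>I'. I' \<in> ?F \<Longrightarrow> I \<subseteq> I' \<Longrightarrow> I = I'"
    by (elim bexE) simp
  have Ii: "I \<in> indep M" "C2 - {x} \<subseteq> I" "I \<subseteq> ?U" using I by blast+
  have dep: "C1 \<notin> indep M" "C2 \<notin> indep M" using C1 C2 unfolding circuits_def by blast+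
  have "\<not> C2 \<subseteq> I" using indep_subset[OF Ii(1)] dep(2) by blast
  then have "x \<notin> I" using Ii(2) by blast
  moreover obtain g where g: "g \<in> C1" "g \<notin> I"
    using indep_subset[OF Ii(1), of C1] dep(1) by blast
  ultimately have "I \<subseteq> ?U - {x, g}" using Ii(3) by blast
  then have "card I \<le> card (?U - {x, g})"
    by (rule card_mono[OF finite_Diff[OF U(2)]])
  also have "\<dots> < card (?U - {e})"
  proof -
    have xg: "x \<noteq> g" using g(1) x(2) by blast
    have "card ?U \<ge> card {x, g}" using U(2) x(1) g(1) by (intro card_mono) auto
    then show ?thesis
      using xg x(1) g(1) e U(2) card_Diff_subset[of "{x, g}" ?U] card_Diff_subset[of "{e}" ?U]
      by simp
  qed
  finally obtain z where z: "z \<in> (?U - {e}) - I" "insert z I \<in> indep M"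
    using indep_augment[OF Ii(1) J] by blast
  then have "insert z I \<in> ?F" using Ii by blast
  then have "I = insert z I" using max by blast
  then show False using z(1) by blast
qed

text \<open>Induction on the size of the union. If the weakly eliminated \<open>C3\<close> misses
  \<open>y\<close>, pick \<open>g\<close> in \<open>C3 - C1\<close>. Eliminating \<open>g\<close>
  from \<open>C2\<close> and \<open>C3\<close> while keeping \<open>e\<close> gives
  \<open>C4\<close>; then \<open>e\<close> is eliminated from \<open>C1\<close> and
  \<open>C4\<close> while keeping \<open>y\<close>. The two unions are smaller because they miss
  \<open>y\<close> and \<open>g\<close> respectively.\<close>

lemma strong_circuit_elimination:
  assumes "C1 \<in> circuits M" "C2 \<in> circuits M" "e \<in> C1" "e \<in> C2" "y \<in> C1" "y \<notin> C2"
  shows "\<exists>C \<in> circuits M. y \<in> C \<and> C \<subseteq> C1 \<union> C2 - {e}"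
  using assms
proof (induction "card (C1 \<union> C2)" arbitrary: C1 C2 e y rule: less_induct)
  case less
  have fin: "finite (C1 \<union> C2)" using less.prems circuit_finite by blast
  obtain C3 where C3: "C3 \<in> circuits M" "C3 \<subseteq> C1 \<union> C2 - {e}"
    using circuit_elimination[of C1 C2 e] less.prems by blast
  show ?case
  proof (cases "y \<in> C3")
    case True
    then show ?thesis using C3 by blast
  next
    case False
    obtain g where g: "g \<in> C3" "g \<notin> C1" "g \<in> C2"
      using circuits_subset_eq[OF C3(1) less.prems(1)] C3 less.prems(3) by blast
    have "C2 \<union> C3 \<subset> C1 \<union> C2" using C3(2) False less.prems(5,6) by blast
    then have "card (C2 \<union> C3) < card (C1 \<union> C2)" by (rule psubset_card_mono[OF fin])
    then obtain C4 where C4: "C4 \<in> circuits M" "e \<in> C4" "C4 \<subseteq> C2 \<union> C3 - {g}"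
      using less.hyps[OF _ less.prems(2) C3(1) g(3,1) less.prems(4)] C3(2) by blast
    have "C1 \<union> C4 \<subset> C1 \<union> C2" using C4(3) C3(2) g by blast
    then have "card (C1 \<union> C4) < card (C1 \<union> C2)" by (rule psubset_card_mono[OF fin])
    moreover have "y \<notin> C4" using C4(3) False less.prems(6) by blast
    ultimately obtain C5 where "C5 \<in> circuits M" "y \<in> C5" "C5 \<subseteq> C1 \<union> C4 - {e}"
      using less.hyps[OF _ less.prems(1) C4(1) less.prems(3) C4(2) less.prems(5)] by blast
    then show ?thesis using C4(3) C3(2) by blast
  qed
qed

section \<open>Ears\<close>

text \<open>Take \<open>C\<close> with the fewest elements outside \<open>X\<close>. A circuit
  violating the last property is a better candidate itself or, if it misses \<open>y\<close>, yields
  one by strong elimination. That property says that \<open>C - X\<close> is a circuit of the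
  contraction of \<open>X\<close>.\<close>

lemma ear_exists:
  assumes B: "B \<in> circuits M" "y \<in> B" "B \<inter> X \<noteq> {}" and y: "y \<notin> X"
  obtains C where "C \<in> circuits M" "y \<in> C" "C \<inter> X \<noteq> {}" "C \<subseteq> X \<union> B"
    "\<And>C'. C' \<in> circuits M \<Longrightarrow> C' \<subseteq> X \<union> C \<Longrightarrow> \<not> C' \<subseteq> X \<Longrightarrow> C - X \<subseteq> C'"
proof -
  let ?P = "\<lambda>C. C \<in> circuits M \<and> y \<in> C \<and> C \<subseteq> X \<union> B"
  define C where "C = (ARG_MIN (\<lambda>C. card (C - X)) C. ?P C)"
  have C: "?P C" and min: "\<And>C'. ?P C' \<Longrightarrow> card (C - X) \<le> card (C' - X)"
    using arg_min_nat_lemma[of ?P B "\<lambda>C. card (C - X)"] B unfolding C_def by blast+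
  have fin: "finite (C - X)" using C circuit_finite by blast
  have meets: "C \<inter> X \<noteq> {}"
  proof
    assume "C \<inter> X = {}"
    then have "C \<subseteq> B" "C \<noteq> B" using C B(3) by blast+
    then show False using circuits_subset_eq[of C M B] C B(1) by blast
  qed
  have minD: False if "?P C'" "C' \<subseteq> X \<union> C" "z \<in> C - X" "z \<notin> C'" for C' z
  proof -
    have "C' - X \<subset> C - X" using that by blast
    then have "card (C' - X) < card (C - X)" by (rule psubset_card_mono[OF fin])
    then show False using min[OF that(1)] by simp
  qed
  have "C - X \<subseteq> C'" if C': "C' \<in> circuits M" "C' \<subseteq> X \<union> C" "\<not> C' \<subseteq> X" for C'
  proof (cases "y \<in> C'")
    case True
    then show ?thesis using minD[of C'] C' C by blast
  next
    case False
    obtain w where w: "w \<in> C'" "w \<notin> X" using C'(3) by blast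
    then have "w \<in> C" using C'(2) by blast
    then obtain C2 where C2: "C2 \<in> circuits M" "y \<in> C2" "C2 \<subseteq> C \<union> C' - {w}"
      using strong_circuit_elimination[of C C' w y] C C' w False by blast
    then show ?thesis using minD[of C2 w] C C' w \<open>w \<in> C\<close> by blast
  qed
  then show thesis using that C meets by blast
qed

text \<open>If \<open>E\<close> meets only \<open>H\<close>, eliminate a common element of
  \<open>E\<close> and \<open>H\<close> while keeping \<open>y\<close>. Should the result
  \<open>E2\<close> miss \<open>G\<close> too, eliminating \<open>y\<close> from \<open>E\<close>
  and \<open>E2\<close> would leave a circuit inside \<open>H - G\<close>, a proper subset of
  \<open>H\<close>.\<close>

lemma circuit_meets_both:
  assumes G: "G \<in> circuits M" and H: "H \<in> circuits M" and GH: "G \<inter> H \<noteq> {}"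
    and E: "E \<in> circuits M" "y \<in> E" "y \<notin> G \<union> H" "E \<inter> (G \<union> H) \<noteq> {}"
    and ear: "\<And>C'. C' \<in> circuits M \<Longrightarrow> C' \<subseteq> (G \<union> H) \<union> E \<Longrightarrow> \<not> C' \<subseteq> G \<union> H \<Longrightarrow>
      E - (G \<union> H) \<subseteq> C'"
  shows "\<exists>B \<in> circuits M. y \<in> B \<and> B \<subseteq> (G \<union> H) \<union> E \<and> B \<inter> G \<noteq> {}"
proof (cases "E \<inter> G = {}")
  case False
  then show ?thesis using E by blast
next
  case True
  then obtain e where e: "e \<in> E" "e \<in> H" using E(4) by blast
  obtain E2 where E2: "E2 \<in> circuits M" "y \<in> E2" "E2 \<subseteq> E \<union> H - {e}"
    using strong_circuit_elimination[of E H e y] E H e by blast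
  have "E2 \<inter> G \<noteq> {}"
  proof
    assume E2G: "E2 \<inter> G = {}"
    have "E \<noteq> E2" using e E2(3) by blast
    then obtain K where K: "K \<in> circuits M" "K \<subseteq> E \<union> E2 - {y}"
      using circuit_elimination[of E E2 y] E E2 by blast
    have "K \<subseteq> G \<union> H"
      using ear[OF K(1)] K(2) E2(3) E(2,3) by blast
    then have "K \<subseteq> H" "K \<inter> G = {}" using K(2) E2G True by blast+
    then show False using circuits_subset_eq[OF K(1) H] GH by blast
  qed
  then show ?thesis using E2 by blast
qed

end

section \<open>Binary matroids\<close>

lemma sum_sym_diff_bit:
  fixes g :: "'a \<Rightarrow> bit"
  assumes "finite X" "finite Y"
  shows "(\<Sum>e\<in>(X - Y) \<union> (Y - X). g e) = sum g X + sum g Y"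
proof -
  have "sum g X = sum g (X - Y) + sum g (X \<inter> Y)"
    using sum.Int_Diff[OF assms(1), of g Y] by (metis add.commute)
  moreover have "sum g Y = sum g (Y - X) + sum g (X \<inter> Y)"
    using sum.Int_Diff[OF assms(2), of g X] by (metis add.commute Int_commute)
  moreover have "sum g ((X - Y) \<union> (Y - X)) = sum g (X - Y) + sum g (Y - X)"
    using assms by (intro sum.union_disjoint) auto
  moreover have "s + s = 0" for s :: bit by (cases s) auto
  ultimately show ?thesis by (metis (no_types, lifting) add.assoc add.commute add.right_neutral)
qed

lemma sum_zero_not_lin_indep:
  assumes "X \<noteq> {}" "\<And>i. i < n \<Longrightarrow> (\<Sum>e\<in>X. v e i) = 0"
  shows "\<not> lin_indep_family_GF2 n v X"
proof
  assume "lin_indep_family_GF2 n v X"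
  then have "(\<forall>i<n. (\<Sum>e\<in>X. 1 * v e i) = 0) \<longrightarrow> (\<forall>e\<in>X. (1 :: bit) = 0)"
    unfolding lin_indep_family_GF2_def by (rule spec[where x = "\<lambda>_. 1"])
  then have "\<forall>e\<in>X. (1 :: bit) = 0" unfolding mult_1_left using assms(2) by blast
  then show False using assms(1) by simp
qed

text \<open>The support of a nontrivial relation among the columns is a dependent subset of
  \<open>C\<close>, hence all of \<open>C\<close> by minimality, and over GF(2) every nonzero
  coefficient is 1.\<close>

lemma binary_circuit_sum_zero:
  assumes rep: "\<And>X. X \<subseteq> ground N \<Longrightarrow> X \<in> indep N \<longleftrightarrow> lin_indep_family_GF2 n v X"
    and fin: "finite (ground N)" and C: "C \<in> circuits N" and i: "i < n"
  shows "(\<Sum>e\<in>C. v e i) = 0"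
proof -
  have Cg: "C \<subseteq> ground N" "finite C" using C fin finite_subset unfolding circuits_def by auto
  have "\<not> lin_indep_family_GF2 n v C" using C rep[OF Cg(1)] unfolding circuits_def by blast
  then have "\<exists>c. (\<forall>i<n. (\<Sum>e\<in>C. c e * v e i) = 0) \<and> (\<exists>e\<in>C. c e \<noteq> 0)"
    unfolding lin_indep_family_GF2_def by (simp only: not_all not_imp ball_simps)
  then obtain c e0 where c: "\<forall>i<n. (\<Sum>e\<in>C. c e * v e i) = 0" "e0 \<in> C" "c e0 \<noteq> 0"
    by (elim exE conjE bexE)
  let ?S = "{e \<in> C. c e \<noteq> 0}"
  have S: "(\<Sum>e\<in>?S. v e i) = 0" if "i < n" for i
  proof -
    have "(\<Sum>e\<in>?S. v e i) = (\<Sum>e\<in>C. c e * v e i)"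
      using Cg(2) by (intro sum.mono_neutral_cong_left) auto
    also have "\<dots> = 0" using c(1) that by blast
    finally show ?thesis .
  qed
  have "\<not> lin_indep_family_GF2 n v ?S"
  proof (rule sum_zero_not_lin_indep)
    show "?S \<noteq> {}" using c(2,3) by blast
  qed (rule S)
  then have "?S \<notin> indep N" using rep[of ?S] Cg(1) by blast
  then have "?S = C" using dependent_subset_circuit_eq[OF C, of ?S] by blast
  then show ?thesis using S[OF i] by simp
qed

text \<open>The columns of the symmetric difference sum to zero, since those of both circuits do and
  common terms cancel. Being nonempty, it is dependent, and \<open>C3\<close> has no proper
  dependent subset.\<close>

lemma binary_sym_diff_within_circuit:
  assumes N: "binary_matroid N"
    and C: "C1 \<in> circuits N" "C2 \<in> circuits N" "C3 \<in> circuits N"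
    and sub: "(C1 - C2) \<union> (C2 - C1) \<subseteq> C3" and ne: "C1 \<noteq> C2"
  shows "(C1 - C2) \<union> (C2 - C1) = C3"
proof -
  let ?S = "(C1 - C2) \<union> (C2 - C1)"
  interpret N: matroid N using N unfolding binary_matroid_def by blast
  obtain n v where "\<forall>X \<subseteq> ground N. X \<in> indep N \<longleftrightarrow> lin_indep_family_GF2 n v X"
    using N unfolding binary_matroid_def by (elim conjE exE)
  then have rep: "X \<in> indep N \<longleftrightarrow> lin_indep_family_GF2 n v X" if "X \<subseteq> ground N" for X
    using that by blast
  have "(\<Sum>e\<in>?S. v e i) = 0" if "i < n" for i
  proof -
    have "(\<Sum>e\<in>C1. v e i) = 0" "(\<Sum>e\<in>C2. v e i) = 0"
      using binary_circuit_sum_zero[OF rep N.finite_ground _ that] C by blast+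
    then show ?thesis
      unfolding sum_sym_diff_bit[OF N.circuit_finite[OF C(1)] N.circuit_finite[OF C(2)]]
      by (metis add_0)
  qed
  moreover have "?S \<noteq> {}" using ne by blast
  ultimately have "\<not> lin_indep_family_GF2 n v ?S"
    using sum_zero_not_lin_indep[of ?S n v] by blast
  moreover have "?S \<subseteq> ground N" using C(1,2) unfolding circuits_def by blast
  ultimately have "?S \<notin> indep N" using rep[of ?S] by blast
  then show ?thesis by (rule dependent_subset_circuit_eq[OF C(3) sub])
qed

section \<open>Images of thetas\<close>

locale binary_hom = matroid M for M :: "'a matroid" +
  fixes N :: "'b matroid" and f :: "'a \<Rightarrow> 'b"
  assumes binary: "binary_matroid N"
    and image_circuit: "C \<in> circuits M \<Longrightarrow> f ` C \<in> circuits N"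
begin

text \<open>The last clause makes \<open>C - A\<close> a circuit of the contraction of
  \<open>A\<close>, so \<open>A \<union> C\<close> has nullity two. Its paths are the complements in
  \<open>A \<union> C\<close> of the circuits it contains; there may be more than three.\<close>

definition theta :: "'a set \<Rightarrow> 'a set \<Rightarrow> bool" where
  "theta A C \<longleftrightarrow> A \<in> circuits M \<and> C \<in> circuits M \<and> A \<inter> C \<noteq> {} \<and> A \<noteq> C \<and>
    (\<forall>C' \<in> circuits M. C' \<subseteq> A \<union> C \<longrightarrow> C' \<noteq> A \<longrightarrow> C - A \<subseteq> C')"

lemma theta_through:
  assumes A: "A \<in> circuits M" and B: "B \<in> circuits M" "y \<in> B" "B \<inter> A \<noteq> {}" and y: "y \<notin> A"
  obtains C where "theta A C" "y \<in> C" "C \<subseteq> A \<union> B"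
proof -
  obtain C where C: "C \<in> circuits M" "y \<in> C" "C \<inter> A \<noteq> {}" "C \<subseteq> A \<union> B"
    "\<And>C'. C' \<in> circuits M \<Longrightarrow> C' \<subseteq> A \<union> C \<Longrightarrow> \<not> C' \<subseteq> A \<Longrightarrow> C - A \<subseteq> C'"
    using ear_exists[OF B y] by blast
  have "C - A \<subseteq> C'" if "C' \<in> circuits M" "C' \<subseteq> A \<union> C" "C' \<noteq> A" for C'
    using C(5)[OF that(1,2)] circuits_subset_eq[OF that(1) A] that(3) by argo
  moreover have "A \<inter> C \<noteq> {}" "A \<noteq> C" using C(2,3) y by blast+
  ultimately have "theta A C" unfolding theta_def using A C(1) by simp
  then show thesis using that C by blast
qed

text \<open>Two circuits other than \<open>A\<close> both contain \<open>C - A\<close>. Eliminating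
  an element of \<open>C - A\<close> from them leaves a circuit that can only be \<open>A\<close>,
  so together they cover \<open>A\<close> as well.\<close>

lemma theta_cover:
  assumes th: "theta A C"
    and K: "K1 \<in> circuits M" "K2 \<in> circuits M" "K1 \<subseteq> A \<union> C" "K2 \<subseteq> A \<union> C" "K1 \<noteq> K2"
  shows "K1 \<union> K2 = A \<union> C"
proof -
  have AC: "A \<in> circuits M" "C \<in> circuits M" "A \<noteq> C"
    and ear: "\<And>C'. C' \<in> circuits M \<Longrightarrow> C' \<subseteq> A \<union> C \<Longrightarrow> C' \<noteq> A \<Longrightarrow> C - A \<subseteq> C'"
    using th unfolding theta_def by blast+
  show ?thesis
  proof (cases "K1 = A \<or> K2 = A")
    case True
    then show ?thesis using ear[of K1] ear[of K2] K by blast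
  next
    case False
    obtain d where d: "d \<in> C - A" using circuits_subset_eq[of C M A] AC by blast
    have sub: "C - A \<subseteq> K1" "C - A \<subseteq> K2" using ear K False by blast+
    then obtain K where K3: "K \<in> circuits M" "K \<subseteq> K1 \<union> K2 - {d}"
      using circuit_elimination[of K1 K2 d] K d by blast
    then have "K = A" using ear[of K] K d by blast
    then show ?thesis using K3(2) sub K(3,4) by blast
  qed
qed

lemma theta_image_constant:
  assumes th: "theta A C" and eq: "f ` C = f ` A" and K: "K \<in> circuits M" "K \<subseteq> A \<union> C"
  shows "f ` K = f ` A"
proof -
  have "f ` (A \<union> C) = f ` A" using eq by (simp add: image_Un)
  then have "f ` K \<subseteq> f ` A" using image_mono[OF K(2), of f] by simp
  moreover have "f ` A \<in> circuits N" using th image_circuit unfolding theta_def by blast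
  ultimately show ?thesis using circuits_subset_eq[OF image_circuit[OF K(1)]] by simp
qed

text \<open>Any two of \<open>A\<close>, \<open>C\<close> and a third circuit \<open>K\<close> cover
  the theta, so the image of \<open>K\<close> contains the symmetric difference of the images of
  \<open>A\<close> and \<open>C\<close>, and by binarity equals it. Each image is then disjoint from
  the intersection of the other two.\<close>

lemma theta_image_split:
  assumes th: "theta A C" and ne: "f ` C \<noteq> f ` A"
  shows "f ` (C - A) \<inter> f ` A = {}" "f ` (A \<inter> C) \<inter> f ` (A - C) = {}"
    "(A - C) \<union> (C - A) \<in> circuits M"
proof -
  have AC: "A \<in> circuits M" "C \<in> circuits M" "A \<noteq> C" "A \<inter> C \<noteq> {}"
    using th unfolding theta_def by blast+
  obtain e where e: "e \<in> A" "e \<in> C" using AC by blast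
  obtain K where K: "K \<in> circuits M" "K \<subseteq> A \<union> C - {e}"
    using circuit_elimination[of A C e] AC e by blast
  have KA: "K \<union> A = A \<union> C" and KC: "K \<union> C = A \<union> C"
    using theta_cover[OF th, of K A] theta_cover[OF th, of K C] AC K e by blast+
  let ?a = "f ` A" and ?c = "f ` C" and ?k = "f ` K"
  have circ: "?a \<in> circuits N" "?c \<in> circuits N" "?k \<in> circuits N"
    using image_circuit AC K by blast+
  have u: "?k \<union> ?a = ?a \<union> ?c" "?k \<union> ?c = ?a \<union> ?c"
    using KA KC by (metis image_Un)+
  have "(?a - ?c) \<union> (?c - ?a) \<subseteq> ?k" using u by blast
  then have k: "(?a - ?c) \<union> (?c - ?a) = ?k"
    using binary_sym_diff_within_circuit[OF binary circ] ne by blast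
  have D: "C - A \<subseteq> K" "A - C \<subseteq> K" using KA KC by blast+
  show "f ` (C - A) \<inter> f ` A = {}"
  proof -
    have "f ` (C - A) \<subseteq> ?k \<inter> ?c" using D(1) by blast
    then show ?thesis using k by blast
  qed
  show "f ` (A \<inter> C) \<inter> f ` (A - C) = {}"
  proof -
    have "f ` (A - C) \<subseteq> ?k \<inter> ?a" "f ` (A \<inter> C) \<subseteq> ?c" using D(2) by blast+
    then show ?thesis using k by blast
  qed
  \<comment> \<open>Elements of \<open>A \<inter> C\<close> have images in
    \<open>?a \<inter> ?c\<close>, which is disjoint from \<open>?k\<close>.\<close>
  have "K \<inter> (A \<inter> C) = {}" using k by blast
  then have "K = (A - C) \<union> (C - A)" using D K(2) by blast
  then show "(A - C) \<union> (C - A) \<in> circuits M" using K(1) by simp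
qed

text \<open>A theta on \<open>G\<close> through \<open>y\<close> must be of the split kind, as
  \<open>f y\<close> is outside \<open>Z\<close>. Its ear \<open>C - G\<close> has image disjoint
  from \<open>Z\<close>, so it avoids \<open>L\<close> and is exactly \<open>E - L\<close>. The
  parts of \<open>G\<close> are \<open>G \<inter> C\<close> and \<open>G - C\<close>.\<close>

lemma ear_splits_circuit:
  assumes G: "G \<in> circuits M" and H: "H \<in> circuits M" and GH: "G \<inter> H \<noteq> {}"
    and L: "L = G \<union> H" and Z: "f ` G = Z" "f ` H = Z"
    and E: "E \<in> circuits M" "y \<in> E" "f y \<notin> Z" "E \<inter> L \<noteq> {}"
    and ear: "\<forall>C' \<in> circuits M. C' \<subseteq> L \<union> E \<longrightarrow> \<not> C' \<subseteq> L \<longrightarrow> E - L \<subseteq> C'"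
  obtains P Q where "G = P \<union> Q" "P \<inter> Q = {}" "P \<union> (E - L) \<in> circuits M"
    "Q \<union> (E - L) \<in> circuits M" "f ` P \<inter> f ` Q = {}" "f ` (E - L) \<inter> Z = {}"
    "P \<noteq> {}" "Q \<noteq> {}"
proof -
  have fL: "f ` L = Z" using L Z by blast
  then have y: "y \<notin> L" using E by blast
  obtain B where B: "B \<in> circuits M" "y \<in> B" "B \<subseteq> L \<union> E" "B \<inter> G \<noteq> {}"
    using circuit_meets_both[OF G H GH E(1,2)] y E(4) ear unfolding L by blast
  obtain C where C: "theta G C" "y \<in> C" "C \<subseteq> G \<union> B"
    using theta_through[OF G B(1,2,4)] y L by blast
  have Cc: "C \<in> circuits M" "G \<inter> C \<noteq> {}" "G \<noteq> C" using C(1) unfolding theta_def by blast+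
  have "f ` C \<noteq> f ` G" using C(2) E(3) Z(1) by blast
  note split = theta_image_split[OF C(1) this]
  have CL: "C \<subseteq> L \<union> E" using C(3) B(3) L by blast
  have "E - L \<subseteq> C" using ear Cc(1) CL y C(2) by blast
  moreover have "(C - G) \<inter> L = {}" using split(1) Z(1) fL by blast
  ultimately have D: "C - G = E - L" using CL L by blast
  have "G - C \<noteq> {}" using circuits_subset_eq[OF G Cc(1)] Cc(3) by blast
  moreover have "(G \<inter> C) \<union> (E - L) = C" using D by blast
  moreover have "f ` (E - L) \<inter> Z = {}" using split(1) D Z(1) by simp
  ultimately show thesis
    using that[of "G \<inter> C" "G - C"] split(2,3) D Cc by auto
qed

lemma theta_image_equal_imp_circuit:
  assumes conn: "\<And>x y. x \<in> ground M \<Longrightarrow> y \<in> ground M \<Longrightarrow> x \<noteq> y \<Longrightarrow>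
      \<exists>C \<in> circuits M. x \<in> C \<and> y \<in> C"
    and onto: "f ` ground M = ground N"
    and th: "theta A C" and eq: "f ` C = f ` A"
  shows "f ` A = ground N"
proof (rule ccontr)
  assume ne: "f ` A \<noteq> ground N"
  define L where "L = A \<union> C"
  define Z where "Z = f ` A"
  have AC: "A \<in> circuits M" "C \<in> circuits M" "A \<inter> C \<noteq> {}" "A \<noteq> C"
    using th unfolding theta_def by blast+
  have const: "f ` K = Z" if "K \<in> circuits M" "K \<subseteq> L" for K
    using theta_image_constant[OF th eq] that unfolding L_def Z_def by blast
  have fA: "f ` A = Z" and fC: "f ` C = Z" using eq unfolding Z_def by blast+
  have ZN: "Z \<in> circuits N" using image_circuit AC(1) unfolding Z_def by blast
  have Ag: "A \<subseteq> ground M" using AC(1) unfolding circuits_def by blast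
  then have "Z \<subseteq> ground N" using onto unfolding Z_def by blast
  then obtain z where "z \<in> ground N" "z \<notin> Z" using ne unfolding Z_def by blast
  then obtain y where y: "y \<in> ground M" "f y \<notin> Z" using onto by (metis imageE)
  have fL: "f ` L = Z" unfolding L_def Z_def using eq by blast
  have yL: "y \<notin> L" using y(2) fL by blast
  obtain a where a: "a \<in> A" using circuit_nonempty[OF AC(1)] by blast
  have "a \<noteq> y" using a yL L_def by blast
  then obtain B where B: "B \<in> circuits M" "y \<in> B" "a \<in> B"
    using conn[of a y] a Ag y(1) by blast
  then have "B \<inter> L \<noteq> {}" using a L_def by blast
  then obtain E where E: "E \<in> circuits M" "y \<in> E" "E \<inter> L \<noteq> {}"
    and ear: "\<forall>C' \<in> circuits M. C' \<subseteq> L \<union> E \<longrightarrow> \<not> C' \<subseteq> L \<longrightarrow> E - L \<subseteq> C'"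
    using ear_exists[OF B(1,2) _ yL] by metis
  define D where "D = E - L"
  have yD: "y \<in> D" using E(2) yL D_def by blast
  obtain P Q where PQ: "A = P \<union> Q" "P \<union> D \<in> circuits M" "Q \<union> D \<in> circuits M"
    "f ` P \<inter> f ` Q = {}" "f ` D \<inter> Z = {}" "P \<noteq> {}" "Q \<noteq> {}"
    using ear_splits_circuit[OF AC(1,2,3) L_def fA fC E(1,2) y(2) E(3) ear]
    unfolding D_def by metis
  have CA: "C \<inter> A \<noteq> {}" "L = C \<union> A" using AC(3) L_def by blast+
  \<comment> \<open>The roles of \<open>A\<close> and \<open>C\<close> are exchanged, but
    \<open>L\<close> and hence the path \<open>D\<close> stay the same.\<close>
  obtain P' Q' where PQ': "C = P' \<union> Q'" "P' \<union> D \<in> circuits M" "Q' \<union> D \<in> circuits M"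
    "f ` P' \<inter> f ` Q' = {}"
    using ear_splits_circuit[OF AC(2,1) CA fC fA E(1,2) y(2) E(3) ear]
    unfolding D_def by metis
  have Zu: "Z = f ` P \<union> f ` Q" "Z = f ` P' \<union> f ` Q'"
    using PQ(1) PQ'(1) eq unfolding Z_def by (metis image_Un)+
  \<comment> \<open>A part is determined by its image: eliminating \<open>y\<close> from two
    different circuits \<open>R \<union> D\<close> and \<open>S \<union> D\<close> destroys
    \<open>D\<close>, leaving a circuit in \<open>R \<union> S\<close>. Its image would be all of
    \<open>Z\<close>, but the common image of \<open>R\<close> and \<open>S\<close> is
    smaller.\<close>
  have same: "R = S" if R: "R \<union> D \<in> circuits M" "R \<subseteq> L" and S: "S \<union> D \<in> circuits M" "S \<subseteq> L"
    and img: "f ` S = f ` R" "f ` R \<noteq> Z" "f ` R \<subseteq> Z" for R S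
  proof (rule ccontr)
    assume "R \<noteq> S"
    then have "R \<union> D \<noteq> S \<union> D" using R(2) S(2) D_def by blast
    then obtain K where K: "K \<in> circuits M" "K \<subseteq> (R \<union> D) \<union> (S \<union> D) - {y}"
      using circuit_elimination[OF R(1) S(1)] yD by blast
    then have "K \<subseteq> L" using ear K R(2) S(2) yD unfolding D_def by blast
    then have "K \<subseteq> R \<union> S" "f ` K = Z" using K const unfolding D_def by blast+
    then show False using img by blast
  qed
  have sub: "P \<subseteq> L" "Q \<subseteq> L" "P' \<subseteq> L" "Q' \<subseteq> L" using PQ(1) PQ'(1) L_def by auto
  have proper: "f ` P \<noteq> Z" "f ` Q \<noteq> Z" using Zu(1) PQ(4,6,7) by blast+
  have PZ: "f ` P \<subseteq> Z" "f ` P' \<subseteq> Z" using Zu by blast+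
  \<comment> \<open>The image of \<open>D\<close> avoids \<open>Z\<close>, so it cancels. What
    remains lies inside the circuit \<open>Z\<close>, and binarity makes it empty or all of
    \<open>Z\<close>.\<close>
  have sd: "(f ` (P \<union> D) - f ` (P' \<union> D)) \<union> (f ` (P' \<union> D) - f ` (P \<union> D))
      = (f ` P - f ` P') \<union> (f ` P' - f ` P)"
    using PQ(5) PZ unfolding image_Un by blast
  have sdZ: "(f ` P - f ` P') \<union> (f ` P' - f ` P) \<subseteq> Z" using Zu by blast
  have "(f ` P - f ` P') \<union> (f ` P' - f ` P) = {} \<or> (f ` P - f ` P') \<union> (f ` P' - f ` P) = Z"
  proof (cases "f ` (P \<union> D) = f ` (P' \<union> D)")
    case True
    then show ?thesis using sd by simp
  next
    case False
    then show ?thesis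
      using binary_sym_diff_within_circuit[OF binary image_circuit[OF PQ(2)]
          image_circuit[OF PQ'(2)] ZN] sd sdZ by simp
  qed
  \<comment> \<open>A subset of \<open>Z\<close> differing from \<open>p\<close> by nothing or by
    all of \<open>Z\<close> is \<open>p\<close> or its complement \<open>q\<close>.\<close>
  moreover have "p' = p \<or> p' = q"
    if "(p - p') \<union> (p' - p) = {} \<or> (p - p') \<union> (p' - p) = Z" "Z = p \<union> q" "p \<inter> q = {}" "p' \<subseteq> Z"
    for p p' q :: "'b set"
    using that by blast
  ultimately have "f ` P' = f ` P \<or> f ` P' = f ` Q" using Zu(1) PQ(4) PZ(2) by presburger
  then show False
  proof
    assume P': "f ` P' = f ` P"
    then have Q': "f ` Q' = f ` Q" using Zu PQ(4) PQ'(4) by blast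
    have "P = P'" using same[OF PQ(2) sub(1) PQ'(2) sub(3) P' proper(1)] Zu by blast
    moreover have "Q = Q'" using same[OF PQ(3) sub(2) PQ'(3) sub(4) Q' proper(2)] Zu by blast
    ultimately show False using PQ(1) PQ'(1) AC(4) by blast
  next
    assume P': "f ` P' = f ` Q"
    then have Q': "f ` Q' = f ` P" using Zu PQ(4) PQ'(4) by blast
    have "Q = P'" using same[OF PQ(3) sub(2) PQ'(2) sub(3) P' proper(2)] Zu by blast
    moreover have "P = Q'" using same[OF PQ(2) sub(1) PQ'(3) sub(4) Q' proper(1)] Zu by blast
    ultimately show False using PQ(1) PQ'(1) AC(4) by blast
  qed
qed

end

theorem theorem1:
  fixes M :: "'a matroid" and N :: "'b matroid" and f :: "'a \<Rightarrow> 'b"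
  assumes "connected_matroid M"
    and "binary_matroid N"
    and "matroid_hom M N f"
  shows "(\<forall>x \<in> ground N. series_class M (f -` {x} \<inter> ground M)) \<or> ground N \<in> circuits N"
proof (cases "\<forall>x \<in> ground N. series_class M (f -` {x} \<inter> ground M)")
  case False
  interpret matroid M using assms(1) unfolding connected_matroid_def by blast
  interpret binary_hom M N f
    using assms(2,3) unfolding matroid_hom_def by unfold_locales blast+
  have conn: "\<exists>C \<in> circuits M. x \<in> C \<and> y \<in> C"
    if "x \<in> ground M" "y \<in> ground M" "x \<noteq> y" for x y
    using assms(1) that unfolding connected_matroid_def by blast
  obtain A x1 x2 where A: "A \<in> circuits M" "x1 \<in> A" "x2 \<notin> A" "f x1 = f x2"
    and g: "x1 \<in> ground M" "x2 \<in> ground M"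
    using False unfolding series_class_def by fastforce
  then obtain B where "B \<in> circuits M" "x1 \<in> B" "x2 \<in> B" using conn[of x1 x2] by blast
  then obtain C where C: "theta A C" "x2 \<in> C"
    using theta_through[of A B x2] A by blast
  \<comment> \<open>The common value of \<open>f\<close> at \<open>x2\<close> in
    \<open>C - A\<close> and at \<open>x1\<close> in \<open>A\<close> rules out the split
    kind.\<close>
  have "f ` (C - A) \<inter> f ` A \<noteq> {}" using A C(2) by force
  then have "f ` C = f ` A" using theta_image_split(1)[OF C(1)] by blast
  then have "f ` A = ground N"
    using theta_image_equal_imp_circuit[OF conn _ C(1)] assms(3)
    unfolding matroid_hom_def by blast
  then show ?thesis using image_circuit[OF A(1)] by simp
qed simp

end
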